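(* Let $G$ be a finite simple undirected graph that is 2-connected. Let $p$ be the order of a longest path in $G$ and $c$ the order of a longest cycle in $G$. If $$\frac{1}{3}\sigma_3\ge \frac{p+2}{3},$$ then $c\ge p-1$.
   Context: All graphs are finite, undirected, without loops or multiple edges. The order of a path or cycle is its number of vertices. A graph is 2-connected if its vertex connectivity is at least 2 (with the connectivity of $K_n$ equal to $n-1$). Let $\alpha$ be the independence number of $G$. If $\alpha\ge 3$, $\sigma_3$ denotes the minimum of $d(x)+d(y)+d(z)$ over all independent sets $\{x,y,z\}$ of three distinct vertices of $G$; if $\alpha<3$, then $\sigma_3=+\infty$ (so the hypothesis on $\sigma_3$ holds automatically). By convention a single vertex and a single edge are regarded as cycles of orders 1 and 2, respectively. *)

theory Defs
  imports "Graph_Theory.Graph_Theory" "HOL-Library.Extended_Real"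
begin

text \<open>
  A finite simple undirected graph is modelled by the locale \<^locale>\<open>graph\<close>, that is, as a finite
  symmetric digraph without loops and parallel arcs. An undirected edge is a pair of
  opposite arcs, so the degree of a vertex is its \<^const>\<open>out_degree\<close>.
\<close>

text \<open>
  \<^const>\<open>Digraph_Component.connected\<close> fails for the graph without vertices, hence the condition that
  something remains after removing \<open>S\<close>.
\<close>

definition vertex_cut :: "('a, 'b) pre_digraph \<Rightarrow> 'a set \<Rightarrow> bool" where
  "vertex_cut G S \<longleftrightarrow>
     S \<subset> verts G \<and> \<not> Digraph_Component.connected (induce_subgraph G (verts G - S))"

definition vertex_connectivity :: "('a, 'b) pre_digraph \<Rightarrow> nat" where
  "vertex_connectivity G =
     (if complete_digraph (card (verts G)) G then card (verts G) - 1
      else Min {card S |S. vertex_cut G S})"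

definition two_connected :: "('a, 'b) pre_digraph \<Rightarrow> bool" where
  "two_connected G \<longleftrightarrow> 2 \<le> vertex_connectivity G"

definition independent_set :: "('a, 'b) pre_digraph \<Rightarrow> 'a set \<Rightarrow> bool" where
  "independent_set G S \<longleftrightarrow> S \<subseteq> verts G \<and> (\<forall>u\<in>S. \<forall>v\<in>S. (u, v) \<notin> arcs_ends G)"

definition independence_number :: "('a, 'b) pre_digraph \<Rightarrow> nat" where
  "independence_number G = Max {card S |S. independent_set G S}"

definition sigma3 :: "('a, 'b) pre_digraph \<Rightarrow> ereal" where
  "sigma3 G =
     (if 3 \<le> independence_number G
      then ereal (real (Min {out_degree G x + out_degree G y + out_degree G z |x y z.
             independent_set G {x, y, z} \<and> x \<noteq> y \<and> x \<noteq> z \<and> y \<noteq> z}))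
      else \<infinity>)"

definition longest_path_order :: "('a, 'b) pre_digraph \<Rightarrow> nat" where
  "longest_path_order G = Max {length q |q. vpath q G}"

text \<open>
  A cycle is given by the list of its vertices, each occurring once. A closing edge is
  demanded only from three vertices on: a single vertex and a single edge count as cycles of
  orders 1 and 2.
\<close>

definition vertex_cycle :: "'a vwalk \<Rightarrow> ('a, 'b) pre_digraph \<Rightarrow> bool" where
  "vertex_cycle q G \<longleftrightarrow> vpath q G \<and> (3 \<le> length q \<longrightarrow> (last q, hd q) \<in> arcs_ends G)"

definition longest_cycle_order :: "('a, 'b) pre_digraph \<Rightarrow> nat" where
  "longest_cycle_order G = Max {length q |q. vertex_cycle q G}"

end

theory Submission
  imports Defs
begin

text \<open>
  Suppose that all cycles have at most \<open>p - 2\<close> vertices. Among the longest paths that run once around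
  a cycle \<open>C\<close> and then leave it along a tail \<open>Q\<close>, choose one with \<open>C\<close> longest. Let \<open>x\<close> be the vertex
  of \<open>C\<close> where \<open>Q\<close> is attached and \<open>q\<close> the far end of \<open>Q\<close>. By 2-connectedness another vertex \<open>y\<close> of
  \<open>C\<close> has a neighbour outside \<open>C\<close>. Take \<open>y\<close> to be the last neighbour of \<open>q\<close> before \<open>x\<close> if there is
  one, and the last vertex before \<open>x\<close> with an outer neighbour otherwise, and let \<open>u\<close> and \<open>w\<close> be the
  successors of \<open>x\<close> and \<open>y\<close> on \<open>C\<close>. If a path outside \<open>C\<close> leads from \<open>y\<close> to \<open>Q\<close>, then by the maximality
  of \<open>C\<close> suitably shifted neighbourhoods of \<open>u\<close>, \<open>w\<close> and \<open>q\<close> are disjoint, and the independent triple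
  \<open>u, w, q\<close> has degree sum at most \<open>p + 1\<close>. Otherwise a longest path from \<open>y\<close> out of \<open>C\<close> misses \<open>Q\<close>,
  and its end together with \<open>w\<close> and \<open>q\<close> has degree sum at most \<open>p\<close>.
\<close>

section \<open>Cuts of lists and counting of positions\<close>

lemma no_consecutive_nth:
  assumes no: "\<And>ys zs. xs = ys @ zs \<Longrightarrow> ys \<noteq> [] \<Longrightarrow> zs \<noteq> [] \<Longrightarrow> P (last ys) \<Longrightarrow> \<not> R (hd zs)"
    and "Suc k < length xs" "P (xs ! k)"
  shows "\<not> R (xs ! Suc k)"
proof -
  have "xs = take (Suc k) xs @ drop (Suc k) xs" by simp
  from no[OF this] show ?thesis
    using assms(2,3) by (cases "xs = []") (auto simp: last_conv_nth hd_drop_conv_nth)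
qed

lemma card_nth_set:
  assumes "distinct xs"
  shows "card {y \<in> set xs. P y} = card {k. k < length xs \<and> P (xs ! k)}"
  by (metis assms distinct_card distinct_filter length_filter_conv_card set_filter)

lemma card_three_disjoint_le:
  assumes "finite S" "A \<subseteq> S" "B \<subseteq> S" "C \<subseteq> S" "A \<inter> B = {}" "A \<inter> C = {}" "B \<inter> C = {}"
  shows "card A + card B + card C \<le> card S"
proof -
  have "card (A \<union> B \<union> C) = card A + card B + card C"
    using assms by (subst card_Un_disjoint; auto simp: card_Un_disjoint finite_subset)
  then show ?thesis
    using assms by (metis Un_least card_mono)
qed

section \<open>Paths and cycles as vertex lists\<close>

locale finite_simple_graph =
  fixes V :: "'a set" and E :: "'a \<Rightarrow> 'a \<Rightarrow> bool"
  assumes finite_V: "finite V"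
    and E_sym: "E x y \<longleftrightarrow> E y x"
    and E_irrefl [simp]: "\<not> E x x"
    and E_in_V: "E x y \<Longrightarrow> x \<in> V"
begin

lemma E_in_V2: "E x y \<Longrightarrow> y \<in> V"
  using E_sym E_in_V by blast

definition deg :: "'a \<Rightarrow> nat" where
  "deg x = card {y. E x y}"

definition is_path :: "'a list \<Rightarrow> bool" where
  "is_path xs \<longleftrightarrow> distinct xs \<and> successively E xs \<and> set xs \<subseteq> V"

definition is_cycle :: "'a list \<Rightarrow> bool" where
  "is_cycle xs \<longleftrightarrow> is_path xs \<and> 3 \<le> length xs \<and> E (last xs) (hd xs)"

lemma is_path_Nil [simp]: "is_path []"
  by (simp add: is_path_def)

lemma is_path_Cons [simp]:
  "is_path (x # xs) \<longleftrightarrow> x \<in> V \<and> x \<notin> set xs \<and> is_path xs \<and> (xs = [] \<or> E x (hd xs))"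
  by (auto simp: is_path_def successively_Cons)

lemma is_path_append [simp]:
  "is_path (xs @ ys) \<longleftrightarrow> is_path xs \<and> is_path ys \<and> set xs \<inter> set ys = {} \<and>
     (xs = [] \<or> ys = [] \<or> E (last xs) (hd ys))"
  by (auto simp: is_path_def successively_append_iff)

lemma is_path_rev [simp]: "is_path (rev xs) \<longleftrightarrow> is_path xs"
  using E_sym by (simp add: is_path_def)

lemma is_path_distinct: "is_path xs \<Longrightarrow> distinct xs"
  by (simp add: is_path_def)

lemma is_path_length: "is_path xs \<Longrightarrow> length xs \<le> card V"
  by (metis card_mono distinct_card finite_V is_path_def)

lemma is_cycle_rotate: "is_cycle (xs @ ys) \<Longrightarrow> is_cycle (ys @ xs)"
  by (cases "xs = []"; cases "ys = []") (auto simp: is_cycle_def)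

lemma is_cycle_rev: "is_cycle (rev xs) \<longleftrightarrow> is_cycle xs"
  using E_sym by (cases "xs = []") (auto simp: is_cycle_def hd_rev last_rev)

lemma is_cycle_ending_at:
  assumes "is_cycle xs" "x \<in> set xs"
  obtains ys where "is_cycle ys" "set ys = set xs" "length ys = length xs" "last ys = x"
proof -
  obtain us vs where "xs = us @ x # vs" using assms(2) by (meson split_list)
  then have "xs = (us @ [x]) @ vs" by simp
  then show ?thesis
    using that[of "vs @ us @ [x]"] assms is_cycle_rotate[of "us @ [x]" vs] by auto
qed

text \<open>A longest such path works: a further neighbour of its end in \<open>S\<close> would
  extend it.\<close>

lemma longest_path_from:
  assumes "z \<in> S" "S \<subseteq> V"
  obtains xs where "is_path xs" "xs \<noteq> []" "hd xs = z" "set xs \<subseteq> S"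
    "\<And>y. E (last xs) y \<Longrightarrow> y \<in> S \<Longrightarrow> y \<in> set xs"
proof -
  let ?P = "\<lambda>xs. is_path xs \<and> xs \<noteq> [] \<and> hd xs = z \<and> set xs \<subseteq> S"
  have "?P [z]" using assms by auto
  moreover have "\<forall>xs. ?P xs \<longrightarrow> length xs < Suc (card V)" using is_path_length less_Suc_eq_le by blast
  ultimately obtain xs where xs: "?P xs" and max: "\<And>ys. ?P ys \<Longrightarrow> length ys \<le> length xs"
    using ex_has_greatest_nat[of ?P "[z]" length "Suc (card V)"] by blast
  have "y \<in> set xs" if "E (last xs) y" "y \<in> S" for y
  proof (rule ccontr)
    assume "y \<notin> set xs"
    then have "?P (xs @ [y])" using xs that assms by auto
    from max[OF this] show False by simp
  qed
  with xs that show ?thesis by blast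
qed

end

section \<open>Lollipops in a hypothetical counterexample\<close>

text \<open>The assumption \<open>leaves\<close> is the only consequence of 2-connectedness that the argument needs.\<close>

locale counterexample = finite_simple_graph +
  fixes p :: nat
  assumes path_le: "is_path xs \<Longrightarrow> length xs \<le> p"
    and path_ex: "\<exists>xs. is_path xs \<and> length xs = p"
    and p_ge_3: "3 \<le> p"
    and cycle_le: "is_cycle xs \<Longrightarrow> length xs + 2 \<le> p"
    and leaves: "S \<subseteq> V - {x} \<Longrightarrow> S \<noteq> {} \<Longrightarrow> S \<noteq> V - {x} \<Longrightarrow> \<exists>s\<in>S. \<exists>t\<in>V - {x} - S. E s t"
    and deg_sum: "x \<in> V \<Longrightarrow> y \<in> V \<Longrightarrow> z \<in> V \<Longrightarrow> x \<noteq> y \<Longrightarrow> x \<noteq> z \<Longrightarrow> y \<noteq> z \<Longrightarrow>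
      \<not> E x y \<Longrightarrow> \<not> E x z \<Longrightarrow> \<not> E y z \<Longrightarrow> p + 2 \<le> deg x + deg y + deg z"
begin

text \<open>Cutting the cycle open next to the attachment vertex gives a path, so
  \<open>path_le\<close> turns the last inequality into an equality.\<close>

definition lollipop :: "'a list \<Rightarrow> 'a list \<Rightarrow> bool" where
  "lollipop D T \<longleftrightarrow> is_cycle D \<and> is_path T \<and> set D \<inter> set T = {} \<and>
     (T \<noteq> [] \<longrightarrow> (\<exists>d\<in>set D. E d (hd T))) \<and> p \<le> length D + length T"

end

text \<open>The cycle is rotated so that its last vertex carries the tail; thus \<open>C @ Q\<close>
  is a longest path.\<close>

locale maximal_lollipop = counterexample +
  fixes C Q :: "'a list"
  assumes C: "is_cycle C" and Q: "is_path Q" and Q_ne: "Q \<noteq> []" and CQ: "set C \<inter> set Q = {}"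
    and att: "E (last C) (hd Q)" and len: "length C + length Q = p"
    and max: "lollipop D T \<Longrightarrow> length D \<le> length C"
begin

section \<open>Neighbourhoods of the distinguished vertices\<close>

lemma no_larger:
  assumes "is_cycle D" "is_path T" "set D \<inter> set T = {}" "T \<noteq> [] \<Longrightarrow> \<exists>d\<in>set D. E d (hd T)"
    "p \<le> length D + length T" "length C < length D"
  shows False
  using max[of D T] assms by (simp add: lollipop_def)

lemma C_facts: "is_path C" "C \<noteq> []" "E (last C) (hd C)" "distinct C" "3 \<le> length C"
  using C by (auto simp: is_cycle_def is_path_distinct)

lemma Q_length: "2 \<le> length Q"
  using cycle_le[OF C] len by simp

text \<open>\<open>hd C\<close> is an end of the longest path \<open>C @ Q\<close>, and a neighbour
  on \<open>Q\<close> would close a larger cycle that leaves the rest of \<open>Q\<close> as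
  tail.\<close>

lemma nbrs_hd: 
  assumes "E (hd C) z" shows "z \<in> set C"
proof (rule ccontr)
  assume z: "z \<notin> set C"
  show False
  proof (cases "z \<in> set Q")
    case False
    then have "is_path (z # C @ Q)"
      using z assms C_facts Q Q_ne CQ att E_in_V2 E_sym by auto
    from path_le[OF this] len show False by simp
  next
    case True
    then obtain Q1 Q2 where Qs: "Q = Q1 @ z # Q2" by (meson split_list)
    have "is_cycle (C @ Q1 @ [z])"
      using C_facts Q CQ att Qs assms E_sym by (auto simp: is_cycle_def hd_append)
    then show False
      using no_larger[of "C @ Q1 @ [z]" Q2] Q CQ Qs len by auto
  qed
qed

text \<open>Reversing the cycle with \<open>last C\<close> kept in place turns this vertex into the
  head.\<close>

lemma nbrs_penultimate:
  assumes "E (last (butlast C)) z" shows "z \<in> set C"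
proof -
  obtain ys x where ys: "C = ys @ [x]" using C_facts by (metis rev_exhaust)
  have ne: "ys \<noteq> []" using C_facts ys by auto
  have "is_cycle ([x] @ ys)" using C ys is_cycle_rotate by blast
  then have "is_cycle (rev ys @ [x])" using is_cycle_rev[of "x # ys"] by simp
  then interpret rev: maximal_lollipop V E p "rev ys @ [x]" Q
    using Q Q_ne CQ att len max ys by unfold_locales auto
  show ?thesis using rev.nbrs_hd[of z] assms ys ne by (auto simp: hd_rev)
qed

lemma nbrs_last_Q:
  assumes "E (last Q) z" shows "z \<in> set C \<union> set Q"
proof (rule ccontr)
  assume z: "z \<notin> set C \<union> set Q"
  have "is_path (C @ Q @ [z])"
    using z assms C_facts Q Q_ne CQ att E_in_V2 by auto
  from path_le[OF this] len show False by simp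
qed

text \<open>Here \<open>hd B\<close> is an end of the longest path that runs backwards from \<open>hd Q\<close> through \<open>Q\<close>, \<open>A\<close> and \<open>B\<close>.\<close>

lemma nbrs_after_end_nbr:
  assumes CAB: "C = A @ B" and ne: "A \<noteq> []" "B \<noteq> []" and qy: "E (last Q) (last A)"
    and wz: "E (hd B) z"
  shows "z \<in> set C"
proof (rule ccontr)
  assume z: "z \<notin> set C"
  note facts = C_facts Q Q_ne CQ att CAB ne qy wz
  show False
  proof (cases "z \<in> set Q")
    case False
    have "is_path (Q @ rev A @ rev B @ [z])"
      using z False facts E_in_V2 E_sym by (auto simp: hd_rev last_rev)
    from path_le[OF this] len CAB show False by simp
  next
    case True
    then obtain Q1 Q2 where Qs: "Q = Q1 @ z # Q2" by (meson split_list)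
    have last: "last Q = (if Q2 = [] then z else last Q2)" using Qs by auto
    \<comment> \<open>The part of \<open>Q\<close> from \<open>z\<close> on fits between
      \<open>last A\<close> and \<open>hd B\<close>; \<open>Q1\<close>, read backwards from
      \<open>z\<close>, becomes the tail.\<close>
    have "is_cycle (A @ rev (z # Q2) @ B)"
      using facts Qs last E_sym by (auto simp: is_cycle_def hd_rev last_rev hd_append split: if_splits)
    moreover have "is_path (rev Q1)" using Q Qs by simp
    moreover have "Q1 \<noteq> [] \<Longrightarrow> E z (hd (rev Q1))" using Q Qs E_sym by (auto simp: hd_rev)
    ultimately show False
      using no_larger[of "A @ rev (z # Q2) @ B" "rev Q1"] facts Qs len is_path_distinct[OF Q] by auto
  qed
qed

section \<open>Degrees counted along the cycle\<close>

text \<open>On \<open>A\<close> and \<open>B\<close> positions are counted instead of vertices, so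
  that neighbourhoods can later be shifted by one.\<close>

lemma deg_split:
  assumes CAB: "C = A @ B" and nb: "\<And>z. E x z \<Longrightarrow> z \<in> set C \<union> set R" and "is_path R" "set C \<inter> set R = {}"
  shows "deg x = card {k. k < length A \<and> E x (A ! k)} + card {k. k < length B \<and> E x (B ! k)}
    + card {y \<in> set R. E x y}"
proof -
  have d: "distinct A" "distinct B" "set A \<inter> set B = {}" using C_facts CAB by auto
  have "{y. E x y} = ({y\<in>set A. E x y} \<union> {y\<in>set B. E x y}) \<union> {y\<in>set R. E x y}"
    using nb CAB by auto
  also have "card \<dots> = card ({y\<in>set A. E x y} \<union> {y\<in>set B. E x y}) + card {y\<in>set R. E x y}"
    using assms(4) CAB by (intro card_Un_disjoint) auto
  also have "card ({y\<in>set A. E x y} \<union> {y\<in>set B. E x y}) = card {y\<in>set A. E x y} + card {y\<in>set B. E x y}"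
    using d by (intro card_Un_disjoint) auto
  finally have "deg x = card {y\<in>set A. E x y} + card {y\<in>set B. E x y} + card {y\<in>set R. E x y}"
    by (simp add: deg_def)
  then show ?thesis using d by (simp add: card_nth_set)
qed

lemma card_nbrs_last:
  assumes "is_path R" "R \<noteq> []"
  shows "card {y \<in> set R. E (last R) y} + 1 \<le> length R"
proof -
  have "{y \<in> set R. E (last R) y} \<subseteq> set R - {last R}" by auto
  then have "card {y \<in> set R. E (last R) y} \<le> card (set R - {last R})" by (simp add: card_mono)
  moreover have "card (set R) = length R" using assms is_path_distinct distinct_card by blast
  moreover have "card (set R - {last R}) = card (set R) - 1" using assms by simp
  moreover have "0 < length R" using assms by simp
  ultimately show ?thesis by linarith
qed

lemma card_nbrs_last_only:
  assumes "\<And>z. z \<in> set (butlast B) \<Longrightarrow> \<not> E x z" "distinct B"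
  shows "card {k. k < length B \<and> E x (B ! k)} \<le> 1"
proof -
  have "{k. k < length B \<and> E x (B ! k)} \<subseteq> {length B - 1}"
  proof safe
    fix k assume "k < length B" "E x (B ! k)"
    then have "\<not> k < length (butlast B)" using assms(1)[of "B ! k"]
      by (metis nth_butlast nth_mem)
    then show "k = length B - 1" using \<open>k < length B\<close> by simp
  qed
  then show ?thesis by (metis card_mono card.empty card.insert finite.intros One_nat_def empty_iff)
qed

section \<open>The two contradictory degree sums\<close>

text \<open>
  The vertices \<open>hd A\<close> and \<open>hd B\<close> follow the attachment vertices \<open>last B\<close> and \<open>last A\<close> on the cycle.
  The path \<open>R @ [r]\<close> reaches the tail from \<open>last A\<close>, and the tail can be left towards either end.
\<close>

lemma bridge_to_tail:
  assumes CAB: "C = A @ B" and ne: "A \<noteq> []" "B \<noteq> []" and Qs: "Q = Q1 @ r # Q2"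
    and R: "is_path (R @ [r])" "set R \<inter> (set C \<union> set Q) = {}" "E (last A) (hd (R @ [r]))"
    and w: "\<And>z. E (hd B) z \<Longrightarrow> z \<in> set C"
    and qB: "\<And>z. z \<in> set (butlast B) \<Longrightarrow> \<not> E (last Q) z"
  shows False
proof -
  \<comment> \<open>\<open>L\<close> leads from \<open>last A\<close> into the tail and back to the
    attachment vertex \<open>last B\<close>, leaving \<open>Q2\<close> as tail.\<close>
  define L where "L = R @ [r] @ rev Q1"
  \<comment> \<open>\<open>M\<close> leads from \<open>last A\<close> to the far end of the tail,
    leaving \<open>Q1\<close> attached at \<open>last B\<close>.\<close>
  define M where "M = R @ [r] @ Q2"
  let ?u = "hd A" and ?w = "hd B" and ?q = "last Q"
  have hdC: "hd C = ?u" and lastC: "last C = last B" using CAB ne by auto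
  have paths: "is_path A" "is_path B" "E (last A) ?w" "set A \<inter> set B = {}" "E (last B) ?u"
    using C_facts CAB ne by auto
  have lenC: "length C = length A + length B" using CAB by simp
  have L: "is_path L" "L \<noteq> []" "E (last A) (hd L)" "E (last L) (last B)" "set A \<inter> set L = {}"
    "set B \<inter> set L = {}"
    using R Q Qs att lastC CQ CAB E_sym by (auto simp: L_def hd_rev last_rev hd_append)
  have lenL: "p \<le> length A + length B + length L + length Q2"
    using len Qs CAB by (simp add: L_def)
  have L_tail: "is_path Q2" "set A \<inter> set Q2 = {}" "set B \<inter> set Q2 = {}" "set L \<inter> set Q2 = {}"
    "Q2 \<noteq> [] \<Longrightarrow> \<exists>d\<in>set L. E d (hd Q2)"
    using R Q Qs CQ CAB is_path_distinct[OF Q] by (auto simp: L_def)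
  have M: "is_path M" "M \<noteq> []" "E (last A) (hd M)" "last M = ?q" "set A \<inter> set M = {}"
    "set B \<inter> set M = {}"
    using R Q Qs CQ CAB by (auto simp: M_def hd_append)
  have M_tail: "is_path Q1" "set A \<inter> set Q1 = {}" "set B \<inter> set Q1 = {}" "set M \<inter> set Q1 = {}"
    "Q1 \<noteq> [] \<Longrightarrow> E (last B) (hd Q1)"
    using R Q Qs CQ CAB att lastC is_path_distinct[OF Q] by (auto simp: M_def)
  have lenM: "p \<le> length A + length B + length M + length Q1"
    using len Qs CAB by (simp add: M_def)
  have longL: False if "is_cycle D" "set D = set A \<union> set B \<union> set L"
    "length D = length A + length B + length L" for D
  proof (rule no_larger[OF that(1) L_tail(1)])
    show "set D \<inter> set Q2 = {}" using that(2) L_tail(2-4) by auto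
    show "\<exists>d\<in>set D. E d (hd Q2)" if "Q2 \<noteq> []" using L_tail(5)[OF that] \<open>set D = _\<close> by blast
    show "p \<le> length D + length Q2" "length C < length D" using that(3) lenL lenC L(2) by auto
  qed
  have longM: False if "is_cycle D" "set D = set A \<union> set B \<union> set M"
    "length D = length A + length B + length M" for D
  proof (rule no_larger[OF that(1) M_tail(1)])
    show "set D \<inter> set Q1 = {}" using that(2) M_tail(2-4) by auto
    show "\<exists>d\<in>set D. E d (hd Q1)" if "Q1 \<noteq> []"
      using M_tail(5)[OF that] \<open>set D = _\<close> ne by (intro bexI[of _ "last B"]) auto
    show "p \<le> length D + length Q1" "length C < length D" using that(3) lenM lenC M(2) by auto
  qed

  have uw: "\<not> E ?u ?w"
  proof
    assume "E ?u ?w"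
    then have "is_cycle (A @ L @ rev B)"
      using L paths ne E_sym C_facts(5) lenC by (auto simp: is_cycle_def hd_rev last_rev)
    from longL[OF this] show False by auto
  qed
  have B_uw: "\<not> E ?w (hd B2)" if "B = B1 @ B2" "B1 \<noteq> []" "B2 \<noteq> []" "E ?u (last B1)" for B1 B2
  proof
    assume e: "E ?w (hd B2)"
    have "is_cycle (A @ L @ rev B2 @ B1)"
      using that e L paths ne E_sym C_facts(5) lenC by (auto simp: is_cycle_def hd_rev last_rev)
    from longL[OF this] that(1) show False by auto
  qed
  have A_uw: "\<not> E ?u (hd A2)" if "A = A1 @ A2" "A1 \<noteq> []" "A2 \<noteq> []" "E ?w (last A1)" for A1 A2
  proof
    assume e: "E ?u (hd A2)"
    have "is_cycle (A2 @ L @ rev B @ rev A1)"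
      using that e L paths ne E_sym C_facts(5) lenC by (auto simp: is_cycle_def hd_rev last_rev)
    from longL[OF this] that(1) show False by auto
  qed
  have A_qw: "\<not> E ?w (hd A2)" if "A = A1 @ A2" "A1 \<noteq> []" "A2 \<noteq> []" "E ?q (last A1)" for A1 A2
  proof
    assume e: "E ?w (hd A2)"
    have "is_cycle (A2 @ M @ rev A1 @ rev B)"
      using that e M paths ne E_sym C_facts(5) lenC by (auto simp: is_cycle_def hd_rev last_rev)
    from longM[OF this] that(1) show False by auto
  qed
  \<comment> \<open>This cycle omits only \<open>a\<close> and so has order \<open>p - 1\<close>,
    against \<open>cycle_le\<close>; hence the gap of two positions.\<close>
  have A_qu: "\<not> E ?u (hd A2)" if "A = A1 @ a # A2" "A1 \<noteq> []" "A2 \<noteq> []" "E ?q (last A1)" for A1 a A2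
  proof
    assume e: "E ?u (hd A2)"
    have "is_cycle (A2 @ B @ Q @ rev A1)"
      using that e Q Q_ne CQ CAB att lastC paths ne E_sym C_facts(5) lenC Q_length
      by (auto simp: is_cycle_def hd_rev last_rev)
    from cycle_le[OF this] len lenC that show False by auto
  qed

  define N where "N x = {k. k < length A \<and> E x (A ! k)}" for x
  define NB where "NB x = {k. k < length B \<and> E x (B ! k)}" for x
  \<comment> \<open>Shifting the neighbours of \<open>hd A\<close> down by one loses none, since
    position 0 is \<open>hd A\<close> itself.\<close>
  define U where "U = {k. Suc k < length A \<and> E ?u (A ! Suc k)}"
  have "N ?u = Suc ` U"
  proof (intro set_eqI iffI)
    fix k assume "k \<in> N ?u"
    moreover from this have "k \<noteq> 0" using ne by (cases "k = 0") (auto simp: N_def hd_conv_nth)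
    ultimately show "k \<in> Suc ` U" by (cases k) (auto simp: N_def U_def)
  qed (auto simp: N_def U_def)
  then have cU: "card (N ?u) = card U" by (simp add: card_image)
  \<comment> \<open>\<open>A_uw\<close> and \<open>A_qw\<close> exclude differences of one,
    \<open>A_qu\<close> a difference of two; the shifts turn all three into disjointness.\<close>
  have "card (N ?w) + card U + card (Suc ` N ?q) \<le> card {..length A}"
  proof (rule card_three_disjoint_le)
    show "N ?w \<inter> U = {}"
      using no_consecutive_nth[of A "E ?w" "E ?u", OF A_uw] by (auto simp: N_def U_def)
    show "N ?w \<inter> Suc ` N ?q = {}"
      using no_consecutive_nth[of A "E ?q" "E ?w", OF A_qw] by (auto simp: N_def)
    have False if k: "k \<in> N ?q" "Suc k \<in> U" for k
    proof -
      have "Suc (Suc k) < length A" using k by (auto simp: U_def)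
      then have A: "A = take (Suc k) A @ A ! Suc k # drop (Suc (Suc k)) A"
        "last (take (Suc k) A) = A ! k" "hd (drop (Suc (Suc k)) A) = A ! Suc (Suc k)"
        "take (Suc k) A \<noteq> []" "drop (Suc (Suc k)) A \<noteq> []"
        using ne by (auto simp: id_take_nth_drop[symmetric] last_conv_nth hd_drop_conv_nth)
      then show False using A_qu[OF A(1,4,5)] k by (simp add: N_def U_def)
    qed
    then show "U \<inter> Suc ` N ?q = {}" by auto
  qed (auto simp: N_def U_def)
  then have A_sum: "card (N ?w) + card (N ?u) + card (N ?q) \<le> length A + 1"
    by (simp add: cU card_image)
  \<comment> \<open>Position 0 of \<open>B\<close> is \<open>hd B\<close>, not its own neighbour, so
    only \<open>length B\<close> slots remain.\<close>
  have "card (NB ?w) + card (Suc ` NB ?u) + card ({} :: nat set) \<le> card {1..length B}"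
  proof (rule card_three_disjoint_le)
    have "0 \<notin> NB ?w" using ne by (auto simp: NB_def hd_conv_nth)
    then show "NB ?w \<subseteq> {1..length B}" by (auto simp: NB_def Suc_le_eq intro: gr0I)
    show "NB ?w \<inter> Suc ` NB ?u = {}"
      using no_consecutive_nth[of B "E ?u" "E ?w", OF B_uw] by (auto simp: NB_def)
  qed (auto simp: NB_def)
  then have B_sum: "card (NB ?w) + card (NB ?u) \<le> length B"
    by (simp add: card_image)
  have q_B: "card (NB ?q) \<le> 1"
    unfolding NB_def using qB paths(2) by (intro card_nbrs_last_only) (auto simp: is_path_distinct)
  have "deg ?u = card (N ?u) + card (NB ?u)"
    using deg_split[OF CAB, of ?u "[]"] nbrs_hd hdC by (simp add: N_def NB_def)
  moreover have "deg ?w = card (N ?w) + card (NB ?w)"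
    using deg_split[OF CAB, of ?w "[]"] w by (simp add: N_def NB_def)
  moreover have "deg ?q = card (N ?q) + card (NB ?q) + card {y\<in>set Q. E ?q y}"
    using deg_split[OF CAB, of ?q Q] nbrs_last_Q Q CQ by (simp add: N_def NB_def)
  moreover have "p + 2 \<le> deg ?u + deg ?w + deg ?q"
  proof (rule deg_sum)
    have "?u \<in> set C" "?w \<in> set C" "?q \<in> set Q" using CAB ne Q_ne by auto
    then show "?u \<in> V" "?w \<in> V" "?q \<in> V" "?u \<noteq> ?q" "?w \<noteq> ?q" "\<not> E ?u ?q" "\<not> E ?w ?q"
      using C_facts(1) Q CQ nbrs_hd hdC w by (auto simp: is_path_def)
    show "?u \<noteq> ?w" using ne paths(4) by (metis disjoint_iff hd_in_set)
  qed (rule uw)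
  \<comment> \<open>The bounds add up to
    \<open>(length A + 1) + length B + 1 + (length Q - 1) = p + 1\<close>.\<close>
  ultimately show False
    using A_sum B_sum q_B card_nbrs_last[OF Q Q_ne] len lenC by linarith
qed

text \<open>
  Second path \<open>S\<close> outside \<open>C\<close>: the independent triple consists of the ends of \<open>Q\<close> and \<open>S\<close> and of \<open>hd B\<close>.
\<close>

lemma second_tail:
  assumes CAB: "C = A @ B" and ne: "A \<noteq> []" "B \<noteq> []"
    and S: "is_path S" "S \<noteq> []" "set S \<inter> (set C \<union> set Q) = {}" "E (last A) (hd S)"
      "\<And>z. E (last S) z \<Longrightarrow> z \<in> set C \<union> set S"
    and w: "\<And>z. E (hd B) z \<Longrightarrow> z \<in> set C"
    and SB: "\<And>z. z \<in> set (butlast B) \<Longrightarrow> \<not> E (last S) z"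
    and qC: "\<And>z. z \<in> set (butlast C) \<Longrightarrow> \<not> E (last Q) z"
  shows False
proof -
  let ?w = "hd B" and ?q = "last Q" and ?s = "last S" and ?m = "length S"
  have hdC: "hd C = hd A" and lastC: "last C = last B" using CAB ne by auto
  have paths: "is_path A" "is_path B" "E (last A) ?w" "set A \<inter> set B = {}" "E (last B) (hd A)"
    using C_facts CAB ne by auto
  have lenC: "length C = length A + length B" using CAB by simp
  \<comment> \<open>This path gives up \<open>A1\<close> and gains \<open>S\<close>, so
    \<open>S\<close> cannot be longer than \<open>A1\<close>.\<close>
  have w_far: "?m \<le> length A1" if "A = A1 @ A2" "A2 \<noteq> []" "E ?w (hd A2)" for A1 A2
  proof -
    have "is_path (rev S @ rev A2 @ B @ Q)"
      using that S paths ne E_sym Q Q_ne CQ CAB att lastC by (auto simp: hd_rev last_rev)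
    from path_le[OF this] show ?thesis using len lenC that by simp
  qed
  have s_far: "?m \<le> length A1" if "A = A1 @ A2" "A2 \<noteq> []" "E ?s (hd A2)" for A1 A2
  proof -
    have "is_path (S @ A2 @ B @ Q)"
      using that S paths ne E_sym Q Q_ne CQ CAB att lastC by (auto simp: hd_rev last_rev)
    from path_le[OF this] show ?thesis using len lenC that by simp
  qed
  have A_sw: "\<not> E ?w (hd A2)" if "A = A1 @ A2" "A1 \<noteq> []" "A2 \<noteq> []" "E ?s (last A1)" for A1 A2
  proof
    assume e: "E ?w (hd A2)"
    have "is_cycle (A2 @ S @ rev A1 @ rev B)"
      using that e S paths ne E_sym C_facts(5) lenC CAB by (auto simp: is_cycle_def hd_rev last_rev)
    then show False
      using no_larger[of "A2 @ S @ rev A1 @ rev B" Q] that Q CQ CAB S att lastC len lenC ne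
      by (auto intro: last_in_set)
  qed
  define N where "N x = {k. k < length A \<and> E x (A ! k)}" for x
  define NB where "NB x = {k. k < length B \<and> E x (B ! k)}" for x
  have w_ge: "?m \<le> k" if "k \<in> N ?w" for k
    using w_far[of "take k A" "drop k A"] that by (auto simp: N_def hd_drop_conv_nth)
  have s_ge: "?m \<le> k" if "k \<in> N ?s" for k
    using s_far[of "take k A" "drop k A"] that by (auto simp: N_def hd_drop_conv_nth)
  have "length A - 1 \<in> N ?w"
    using paths(3) ne E_sym by (auto simp: N_def last_conv_nth)
  from w_ge[OF this] have mA: "?m < length A" using ne S(2) by (cases A) auto
  \<comment> \<open>The first \<open>?m\<close> positions of \<open>A\<close> hold no neighbours of
    \<open>?w\<close> or \<open>?s\<close>; this gap pays for the neighbours of \<open>?s\<close>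
    inside \<open>S\<close>.\<close>
  have "card (N ?w) + card {..<?m} + card (Suc ` N ?s) \<le> card {..length A}"
  proof (rule card_three_disjoint_le)
    show "N ?w \<inter> Suc ` N ?s = {}"
      using no_consecutive_nth[of A "E ?s" "E ?w", OF A_sw] by (auto simp: N_def)
    show "{..<?m} \<subseteq> {..length A}" using mA by auto
    show "N ?w \<inter> {..<?m} = {}" using w_ge by fastforce
    show "{..<?m} \<inter> Suc ` N ?s = {}" using s_ge by fastforce
  qed (auto simp: N_def)
  then have A_sum: "card (N ?w) + ?m + card (N ?s) \<le> length A + 1"
    by (simp add: card_image)
  have "NB ?w \<subseteq> {..<length B} - {0}" using ne by (auto simp: NB_def hd_conv_nth)
  then have "card (NB ?w) \<le> card ({..<length B} - {0})" by (rule card_mono[rotated]) simp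
  then have B_w: "card (NB ?w) + 1 \<le> length B" using ne by (cases B) auto
  have B_s: "card (NB ?s) \<le> 1"
    unfolding NB_def using SB paths(2) by (intro card_nbrs_last_only) (auto simp: is_path_distinct)
  have "card {k. k < length C \<and> E ?q (C ! k)} \<le> 1"
    using qC C_facts by (intro card_nbrs_last_only)
  then have "deg ?q \<le> 1 + card {y\<in>set Q. E ?q y}"
    using deg_split[of C "[]" ?q Q] nbrs_last_Q Q CQ by simp
  moreover have "deg ?w = card (N ?w) + card (NB ?w)"
    using deg_split[OF CAB, of ?w "[]"] w by (simp add: N_def NB_def)
  moreover have "deg ?s = card (N ?s) + card (NB ?s) + card {y\<in>set S. E ?s y}"
    using deg_split[OF CAB, of ?s S] S by (auto simp: N_def NB_def)
  moreover have "p + 2 \<le> deg ?q + deg ?s + deg ?w"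
  proof (rule deg_sum)
    have i: "?w \<in> set C" "?s \<in> set S" "?q \<in> set Q" using CAB ne Q_ne S by auto
    show "?q \<in> V" "?s \<in> V" "?w \<in> V"
      using i C_facts(1) Q S(1) by (auto simp: is_path_def)
    show "?q \<noteq> ?s" "?q \<noteq> ?w" "?s \<noteq> ?w"
      using i CQ S(3) by auto
    show "\<not> E ?q ?s" using nbrs_last_Q[of ?s] i S by blast
    show "\<not> E ?q ?w" "\<not> E ?s ?w" using w E_sym i CQ S by blast+
  qed
  \<comment> \<open>The bounds are \<open>length Q\<close> for \<open>?q\<close>, and
    \<open>length A + 1 - ?m\<close>, \<open>length B - 1\<close>, \<open>1\<close> and
    \<open>?m - 1\<close> for the other two ends; their sum is \<open>p\<close>.\<close>
  ultimately show False
    using A_sum B_w B_s card_nbrs_last[OF Q Q_ne] card_nbrs_last[OF S(1,2)] len lenC by linarith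
qed

section \<open>Choice of the second attachment vertex\<close>

lemma split_last_property:
  assumes "z \<in> set (butlast C)" "P z"
  obtains A B where "C = A @ B" "A \<noteq> []" "B \<noteq> []" "P (last A)" "\<And>z. z \<in> set (butlast B) \<Longrightarrow> \<not> P z"
proof -
  obtain ys y zs where ys: "butlast C = ys @ y # zs" "P y" "\<forall>z\<in>set zs. \<not> P z"
    using split_list_last_prop[of "butlast C" P] assms by blast
  have "C = butlast C @ [last C]" using C_facts(2) by simp
  then have "C = (ys @ [y]) @ zs @ [last C]" by (simp add: ys(1))
  then show ?thesis using that[of "ys @ [y]" "zs @ [last C]"] ys by auto
qed

lemma contradiction: False
proof (cases "\<exists>z\<in>set (butlast C). E (last Q) z")
  case True
  then obtain A B where AB: "C = A @ B" "A \<noteq> []" "B \<noteq> []" "E (last Q) (last A)"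
    "\<And>z. z \<in> set (butlast B) \<Longrightarrow> \<not> E (last Q) z"
    using split_last_property[of _ "E (last Q)"] by blast
  \<comment> \<open>The edge from \<open>last A\<close> to \<open>last Q\<close> is itself the
    bridge, so \<open>R\<close> and \<open>Q2\<close> are empty.\<close>
  show False
  proof (rule bridge_to_tail[of A B "butlast Q" "last Q" "[]" "[]"])
    show "Q = butlast Q @ [last Q]" using Q_ne by simp
    show "is_path ([] @ [last Q])" using Q Q_ne by (auto simp: is_path_def)
  qed (use AB E_sym nbrs_after_end_nbr in auto)
next
  case False
  define outer where "outer y \<longleftrightarrow> (\<exists>z. z \<notin> set C \<and> E y z)" for y
  have C_split: "C = butlast C @ [last C]" using C_facts by simp
  have x: "last C \<notin> set (butlast C)" using C_facts(4) C_split
    by (metis distinct_append disjoint_iff list.set_intros(1))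
  have setC: "set C = insert (last C) (set (butlast C))"
    by (metis C_split Un_insert_right list.set(1,2) set_append sup_bot.right_neutral)
  have CV: "set C \<subseteq> V" using C_facts by (simp add: is_path_def)
  have qV: "last Q \<in> V - set C" using Q Q_ne CQ by (auto simp: is_path_def)
  have "set (butlast C) \<noteq> {}" using C_facts(5) by (cases C) auto
  moreover have "set (butlast C) \<noteq> V - {last C}" using setC qV by auto
  ultimately have "\<exists>s\<in>set (butlast C). \<exists>t\<in>V - {last C} - set (butlast C). E s t"
    using leaves[of "set (butlast C)" "last C"] x setC CV by blast
  then obtain s where "s \<in> set (butlast C)" "outer s" using setC by (auto simp: outer_def)
  then obtain A B where AB: "C = A @ B" "A \<noteq> []" "B \<noteq> []" "outer (last A)"
    "\<And>z. z \<in> set (butlast B) \<Longrightarrow> \<not> outer z"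
    using split_last_property[of _ outer] by blast
  \<comment> \<open>If \<open>B\<close> is a single vertex, \<open>last A\<close> precedes the
    attachment vertex and cannot be outer, so that case is void. Otherwise \<open>hd B\<close> lies
    beyond the last outer vertex of \<open>butlast C\<close>.\<close>
  have w: "z \<in> set C" if "E (hd B) z" for z
  proof (cases "length B = 1")
    case True
    then have "last (butlast C) = last A" using AB by (cases B) auto
    then show ?thesis using nbrs_penultimate AB(4) by (auto simp: outer_def)
  next
    case False
    then have "hd B \<in> set (butlast B)" using AB(3) by (cases B) auto
    then show ?thesis using AB(5) that by (auto simp: outer_def)
  qed
  obtain z where z: "z \<notin> set C" "E (last A) z" using AB(4) by (auto simp: outer_def)
  obtain S where S: "is_path S" "S \<noteq> []" "hd S = z" "set S \<subseteq> V - set C"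
    "\<And>y. E (last S) y \<Longrightarrow> y \<in> V - set C \<Longrightarrow> y \<in> set S"
    using longest_path_from[of z "V - set C"] z E_in_V2 by (metis Diff_iff Diff_subset)
  show False
  proof (cases "set S \<inter> set Q = {}")
    case True
    show False
    proof (rule second_tail[OF AB(1-3) S(1,2)])
      show "set S \<inter> (set C \<union> set Q) = {}" using True S(4) by auto
      show "E (last A) (hd S)" using z S by simp
      show "z \<in> set C \<union> set S" if "E (last S) z" for z using S(5)[OF that] E_in_V2[OF that] by blast
      show "\<not> E (last S) z" if "z \<in> set (butlast B)" for z
        using AB(5)[OF that] S(2,4) E_sym by (auto simp: outer_def dest: last_in_set)
      show "\<not> E (last Q) z" if "z \<in> set (butlast C)" for z using False that by blast
    qed (rule w)
  next
    case meet: False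
    \<comment> \<open>Stopping at the first vertex of \<open>S\<close> on \<open>Q\<close> keeps
      \<open>R\<close> off the tail.\<close>
    obtain R r S2 where R: "S = R @ r # S2" "r \<in> set Q" "\<forall>y\<in>set R. y \<notin> set Q"
      using split_list_first_prop[of S "\<lambda>y. y \<in> set Q"] meet by blast
    obtain Q1 Q2 where Qs: "Q = Q1 @ r # Q2" using R(2) by (meson split_list)
    show False
    proof (rule bridge_to_tail[OF AB(1-3) Qs])
      show "is_path (R @ [r])" using S(1) R(1) by auto
      show "set R \<inter> (set C \<union> set Q) = {}" using R S(4) by auto
      show "E (last A) (hd (R @ [r]))" using z S(3) R(1) by (cases R) auto
      show "\<not> E (last Q) z" if "z \<in> set (butlast B)" for z
        using False that AB by (auto simp: butlast_append)
    qed (rule w)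
  qed
qed

end

section \<open>Existence of a maximal lollipop\<close>

context counterexample
begin

text \<open>On a longest path the end \<open>x\<close> has a neighbour other than the second vertex.
  By maximality it lies on the path, so an initial segment closes to a cycle and the rest is the
  tail.\<close>

lemma initial_lollipop: "\<exists>D T. lollipop D T"
proof -
  obtain xs where xs: "is_path xs" "length xs = p" using path_ex by blast
  then have "Suc (Suc (Suc 0)) \<le> length xs" using p_ge_3 by simp
  then obtain x y zs where xyz: "xs = x # y # zs" "zs \<noteq> []"
    by (auto simp: Suc_le_length_iff)
  have "\<exists>s\<in>{x}. \<exists>t\<in>V - {y} - {x}. E s t"
  proof (rule leaves)
    have "hd zs \<in> V - {y}" "hd zs \<noteq> x" using xs(1) xyz by (cases zs; auto)+
    then show "{x} \<noteq> V - {y}" by blast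
  qed (use xs(1) xyz in auto)
  then obtain t where t: "t \<noteq> y" "E x t" by blast
  have "t \<in> set zs"
  proof (rule ccontr)
    assume "t \<notin> set zs"
    then have "is_path (t # xs)" using xs(1) xyz t E_sym E_in_V2 by auto
    from path_le[OF this] xs(2) show False by simp
  qed
  then obtain us vs where uv: "zs = us @ t # vs" by (meson split_list)
  have "lollipop (x # y # us @ [t]) vs"
    unfolding lollipop_def is_cycle_def
    using xs xyz uv t E_sym by (auto simp: hd_append)
  then show ?thesis by blast
qed

lemma inconsistent: False
proof -
  have bound: "length D \<le> p" if "lollipop D T" for D T
    using that path_le by (auto simp: lollipop_def is_cycle_def)
  obtain D0 T0 where "lollipop D0 T0" using initial_lollipop by blast
  then have "\<exists>D. (\<exists>T. lollipop D T) \<and> (\<forall>D'. (\<exists>T. lollipop D' T) \<longrightarrow> length D' \<le> length D)"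
    using bound ex_has_greatest_nat[of "\<lambda>D. \<exists>T. lollipop D T" D0 length "Suc p"]
    by (metis less_Suc_eq_le)
  then obtain D T where DT: "lollipop D T" and max: "\<And>D' T'. lollipop D' T' \<Longrightarrow> length D' \<le> length D"
    by blast
  have "T \<noteq> []" using DT cycle_le[of D] by (auto simp: lollipop_def)
  then obtain d where d: "d \<in> set D" "E d (hd T)" using DT by (auto simp: lollipop_def)
  have "is_cycle D" using DT by (simp add: lollipop_def)
  from is_cycle_ending_at[OF this d(1)]
  obtain C where C: "is_cycle C" "set C = set D" "length C = length D" "last C = d" .
  have CT: "is_path T" "set C \<inter> set T = {}" "p \<le> length C + length T"
    using DT C by (auto simp: lollipop_def)
  have "is_path (C @ T)"
    using C(1,4) CT d(2) by (auto simp: is_cycle_def)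
  from path_le[OF this] have len: "length C + length T = p" using CT(3) by simp
  interpret maximal_lollipop V E p C T
  proof
    show "E (last C) (hd T)" using C(4) d(2) by simp
    show "length D' \<le> length C" if "lollipop D' T'" for D' T' using max[OF that] C(3) by simp
  qed (use C(1) CT \<open>T \<noteq> []\<close> len in auto)
  show False by (rule contradiction)
qed

end

section \<open>Transfer to digraphs\<close>

lemma vwalk_arcs_subset_iff:
  "set (vwalk_arcs q) \<subseteq> R \<longleftrightarrow> successively (\<lambda>x y. (x, y) \<in> R) q"
  by (induction q rule: vwalk_arcs.induct) auto

context graph
begin

lemma arcs_ends_verts: "(u, v) \<in> arcs_ends G \<Longrightarrow> u \<in> verts G \<and> v \<in> verts G"
  by (auto simp: arcs_ends_conv)

lemma arcs_ends_sym: "(u, v) \<in> arcs_ends G \<longleftrightarrow> (v, u) \<in> arcs_ends G"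
  using arcs_ends_symmetric[OF sym_arcs] by blast

sublocale simple: finite_simple_graph "verts G" "\<lambda>u v. (u, v) \<in> arcs_ends G"
proof
  show "(x, x) \<notin> arcs_ends G" for x using no_loops by (auto simp: arcs_ends_conv)
  show "(x, y) \<in> arcs_ends G \<longleftrightarrow> (y, x) \<in> arcs_ends G" for x y by (rule arcs_ends_sym)
qed (auto dest: arcs_ends_verts)

lemma vpath_iff: "vpath q G \<longleftrightarrow> q \<noteq> [] \<and> simple.is_path q"
  by (auto simp: vpath_def vwalk_def simple.is_path_def vwalk_arcs_subset_iff)

lemma deg_eq_out_degree: "simple.deg x = out_degree G x"
proof -
  have "inj_on (head G) (out_arcs G x)"
    using no_multi_arcs by (auto simp: inj_on_def arc_to_ends_def)
  moreover have "head G ` out_arcs G x = {y. (x, y) \<in> arcs_ends G}"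
    by (auto simp: arcs_ends_conv)
  ultimately show ?thesis
    unfolding simple.deg_def out_degree_def by (metis card_image)
qed

lemma finite_lengths: "(\<And>q. P q \<Longrightarrow> vpath q G) \<Longrightarrow> finite {length q |q. P q}"
  by (rule finite_subset[of _ "{..card (verts G)}"]) (auto simp: vpath_iff simple.is_path_length)

lemma finite_independent: "finite {S. independent_set G S}"
  by (rule finite_subset[of _ "Pow (verts G)"]) (auto simp: independent_set_def)

lemma vpath_le_longest: "vpath q G \<Longrightarrow> length q \<le> longest_path_order G"
  unfolding longest_path_order_def by (rule Max_ge) (auto intro: finite_lengths)

lemma vertex_cycle_le_longest: "vertex_cycle q G \<Longrightarrow> length q \<le> longest_cycle_order G"
  unfolding longest_cycle_order_def
  by (rule Max_ge) (auto intro: finite_lengths simp: vertex_cycle_def)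

lemma longest_vpath_exists:
  assumes "verts G \<noteq> {}"
  obtains q where "vpath q G" "length q = longest_path_order G"
proof -
  obtain v where "v \<in> verts G" using assms by blast
  then have "vpath [v] G" by (simp add: vpath_iff)
  then have "longest_path_order G \<in> {length q |q. vpath q G}"
    unfolding longest_path_order_def by (intro Max_in) (auto intro: finite_lengths)
  then show ?thesis using that by auto
qed

text \<open>Connectedness means reachability in the symmetrised digraph, and by induction a walk
  from \<open>S\<close> never leaves \<open>S\<close>.\<close>

lemma not_connected_if_no_leaving_edge:
  assumes "S \<noteq> {}" "S \<subset> W" "\<And>s t. s \<in> S \<Longrightarrow> t \<in> W - S \<Longrightarrow> (s, t) \<notin> arcs_ends G"
  shows "\<not> Digraph_Component.connected (induce_subgraph G W)"
proof
  let ?H = "with_proj (mk_symmetric (induce_subgraph G W))"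
  assume "Digraph_Component.connected (induce_subgraph G W)"
  moreover obtain s t where st: "s \<in> S" "t \<in> W - S" using assms by blast
  ultimately have "s \<rightarrow>\<^sup>*\<^bsub>?H\<^esub> t"
    using assms(2) by (auto simp: connected_def strongly_connected_def mk_symmetric_def)
  then have "(s, t) \<in> rtrancl_on (verts ?H) (arcs_ends ?H)" by (simp add: reachable_def)
  then have "t \<in> S"
  proof (induction rule: rtrancl_on_induct)
    case base
    show ?case by (rule st)
  next
    case (step y z)
    then have "(y, z) \<in> arcs_ends G" "z \<in> W"
      using arcs_ends_sym[of z y] by (auto simp: mk_symmetric_def arcs_ends_conv)
    then show ?case using assms(3) step by blast
  qed
  then show False using st by blast
qed

text \<open>Without such an edge, deleting \<open>x\<close> would separate \<open>S\<close> from the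
  rest, a cut of at most one vertex.\<close>

lemma two_connected_leaving_edge:
  assumes "two_connected G" and S: "S \<subseteq> verts G - {x}" "S \<noteq> {}" "S \<noteq> verts G - {x}"
  shows "\<exists>s\<in>S. \<exists>t\<in>verts G - {x} - S. (s, t) \<in> arcs_ends G"
proof (rule ccontr)
  assume no: "\<not> ?thesis"
  show False
  proof (cases "complete_digraph (card (verts G)) G")
    case True
    obtain s t where "s \<in> S" "t \<in> verts G - {x} - S" using S by blast
    moreover from this have "(s, t) \<in> arcs_ends G"
      using True S(1) by (auto simp: complete_digraph_def)
    ultimately show False using no by blast
  next
    case False
    \<comment> \<open>\<open>x\<close> may lie outside the graph; then \<open>T\<close> is
      empty.\<close>
    define T where "T = verts G \<inter> {x}"
    have "\<not> Digraph_Component.connected (induce_subgraph G (verts G - T))"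
      using no S by (intro not_connected_if_no_leaving_edge[of S]) (auto simp: T_def)
    moreover have "T \<subset> verts G" using S by (auto simp: T_def)
    ultimately have "vertex_cut G T" by (simp add: vertex_cut_def)
    moreover have "finite {card U |U. vertex_cut G U}"
      by (rule finite_subset[of _ "{..card (verts G)}"]) (auto simp: vertex_cut_def intro!: card_mono)
    ultimately have "Min {card U |U. vertex_cut G U} \<le> card T"
      by (intro Min_le) auto
    also have "card T \<le> card {x}" by (rule card_mono) (auto simp: T_def)
    finally show False using assms(1) False by (simp add: two_connected_def vertex_connectivity_def)
  qed
qed

text \<open>The triple itself forces independence number at least 3, so the finite branch of
  \<open>sigma3\<close> applies.\<close>

lemma sigma3_le:
  assumes ind: "independent_set G {x, y, z}" "x \<noteq> y" "x \<noteq> z" "y \<noteq> z"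
  shows "sigma3 G \<le> ereal (real (out_degree G x + out_degree G y + out_degree G z))"
proof -
  have "card {x, y, z} \<in> {card S |S. independent_set G S}" using ind by blast
  moreover have "finite {card S |S. independent_set G S}"
    using finite_independent by (auto simp: setcompr_eq_image)
  ultimately have "card {x, y, z} \<le> independence_number G"
    unfolding independence_number_def by (rule Max_ge[rotated])
  then have 3: "3 \<le> independence_number G" using ind by simp
  let ?D = "{out_degree G x + out_degree G y + out_degree G z |x y z.
    independent_set G {x, y, z} \<and> x \<noteq> y \<and> x \<noteq> z \<and> y \<noteq> z}"
  have "?D \<subseteq> (\<lambda>(x, y, z). out_degree G x + out_degree G y + out_degree G z) `
      (verts G \<times> verts G \<times> verts G)"
    by (force simp: independent_set_def)
  then have "finite ?D" by (rule finite_subset) simp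
  then have "Min ?D \<le> out_degree G x + out_degree G y + out_degree G z"
    using ind by (intro Min_le) blast+
  then show ?thesis unfolding sigma3_def using 3 by simp
qed

end

theorem theorem2:
  fixes G :: "('a, 'b) pre_digraph" and p c :: nat
  assumes "graph G"
    and "two_connected G"
    and "p = longest_path_order G"
    and "c = longest_cycle_order G"
    and "(1 / 3) * sigma3 G \<ge> ereal ((real p + 2) / 3)"
  shows "real c \<ge> real p - 1"
proof (rule ccontr)
  interpret graph G by fact
  assume "\<not> real c \<ge> real p - 1"
  then have cp: "c + 2 \<le> p" by linarith
  \<comment> \<open>The empty graph counts as complete, and \<open>card (verts G) - 1\<close>
    truncates to 0.\<close>
  have "verts G \<noteq> {}"
  proof
    assume "verts G = {}"
    moreover from this have "arcs G = {}" using tail_in_verts by blast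
    ultimately show False
      using assms(1,2)
      by (simp add: two_connected_def vertex_connectivity_def complete_digraph_def arcs_ends_conv)
  qed
  then obtain v q where v: "v \<in> verts G" and q: "vpath q G" "length q = p"
    using longest_vpath_exists assms(3) by (metis ex_in_conv)
  \<comment> \<open>The convention that one vertex is a cycle gives \<open>1 \<le> c\<close>, hence
    \<open>3 \<le> p\<close>.\<close>
  have "vertex_cycle [v] G" using v by (simp add: vertex_cycle_def vpath_iff)
  from vertex_cycle_le_longest[OF this] have "1 \<le> c" using assms(4) by simp
  interpret counterexample "verts G" "\<lambda>u v. (u, v) \<in> arcs_ends G" p
  proof
    show "length xs \<le> p" if "simple.is_path xs" for xs
      using that vpath_le_longest[of xs] assms(3) by (cases "xs = []") (auto simp: vpath_iff)
    show "\<exists>xs. simple.is_path xs \<and> length xs = p" using q by (auto simp: vpath_iff)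
    show "3 \<le> p" using cp \<open>1 \<le> c\<close> by simp
    show "length xs + 2 \<le> p" if "simple.is_cycle xs" for xs
    proof -
      have "vertex_cycle xs G"
        using that by (auto simp: vertex_cycle_def vpath_iff simple.is_cycle_def)
      then show ?thesis using vertex_cycle_le_longest[of xs] cp assms(4) by simp
    qed
    show "\<exists>s\<in>S. \<exists>t\<in>verts G - {x} - S. (s, t) \<in> arcs_ends G"
      if "S \<subseteq> verts G - {x}" "S \<noteq> {}" "S \<noteq> verts G - {x}" for S x
      using two_connected_leaving_edge[OF assms(2) that] .
    show "p + 2 \<le> simple.deg x + simple.deg y + simple.deg z"
      if "x \<in> verts G" "y \<in> verts G" "z \<in> verts G" "x \<noteq> y" "x \<noteq> z" "y \<noteq> z"
        "(x, y) \<notin> arcs_ends G" "(x, z) \<notin> arcs_ends G" "(y, z) \<notin> arcs_ends G" for x y z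
    proof -
      have "independent_set G {x, y, z}"
        using that arcs_ends_sym by (auto simp: independent_set_def)
      from sigma3_le[OF this that(4-6)]
      have "(1 / 3) * sigma3 G \<le> (1 / 3) * ereal (real (simple.deg x + simple.deg y + simple.deg z))"
        by (intro ereal_mult_left_mono) (auto simp: deg_eq_out_degree)
      with assms(5) have "ereal ((real p + 2) / 3) \<le> (1 / 3) * ereal (real (simple.deg x + simple.deg y + simple.deg z))"
        by (rule order_trans)
      then show ?thesis by (simp add: one_ereal_def numeral_eq_ereal)
    qed
  qed
  show False by (rule inconsistent)
qed

end
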